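(* $\lambda=(\lambda_{(S,R)})_{(S,R)\in \mathrm{Ob}\,\mathcal{E}}$, where $$\lambda_{(S,R)}:\mathrm{Spec}\,S\to\mathrm{NC}(S,R),\qquad P\mapsto \psi_{(S,R)}(P)/\psi_{(S,R)}(N(S)),$$ is a natural transformation from the contravariant functor $\mathrm{Spec}\circ W$ to the contravariant functor $\mathrm{NC}$ (both regarded as functors from $\mathcal{E}$ to the category of topological spaces and continuous functions).
   Context: "Ring" means commutative ring, not necessarily with identity. Prime ideals are proper by definition. $\mathrm{Spec}\,S$ is the set of prime ideals of the ring $S$ with the Zariski topology, which has as a basis the sets $D_S(a)=\{P\in\mathrm{Spec}\,S: a\notin P\}$, $a\in S$. $N(S)$ is the nilradical of $S$, i.e. the intersection of all prime ideals of $S$ (equal to $S$ if there are none). An i-extension of $S$ is a ring $R$ containing $S$ as an ideal. For an i-extension $R$ of $S$ and an ideal $I$ of $S$, put $\psi_{(S,R)}(I)=\{x\in R: xS\subseteq I\}$, an ideal of $R$; it is prime in $R$ when $I$ is a prime ideal of $S$. $\mathcal{E}$ is the category whose objects are the pairs $(S,R)$ with $R$ a unitary ring that is an i-extension of the ring $S$, and whose morphisms $(S_1,R_1)\to(S_2,R_2)$ are the homomorphisms of unitary rings $h:R_1\to R_2$ such that $h(S_1)=S_2$. $W$ is the functor from $\mathcal{E}$ to the category of commutative rings and surjective homomorphisms sending $h:(S,R)\to(T,M)$ to $h|_S:S\to T$. $Q$ is the functor from $\mathcal{E}$ to unitary commutative rings with $Q(S,R)=R/\psi_{(S,R)}(N(S))$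 and, for $h:(S,R)\to(T,M)$, $Q(h): r+\psi_{(S,R)}(N(S))\mapsto h(r)+\psi_{(T,M)}(N(T))$. $\mathrm{Spec}$ acts contravariantly on unitary homomorphisms and on surjective homomorphisms by inverse image of prime ideals. $\mathrm{NC}=\mathrm{Spec}\circ Q$; the space $\mathrm{NC}(S,R)=\mathrm{Spec}(R/\psi_{(S,R)}(N(S)))$ is called the $R$-nilcompactification of $\mathrm{Spec}\,S$. *)

theory Defs
  imports "HOL-Algebra.QuotRing" "HOL-Analysis.Abstract_Topology"
begin

section \<open>Commutative rings that need not have an identity\<close>

text \<open>
  The records of HOL-Algebra are reused; the field \<open>one\<close> of such a record is ignored
  unless the ring is explicitly assumed to be unitary, i.e. a \<open>cring\<close>.
\<close>

locale comm_rng = abelian_group R for R (structure) +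
  assumes m_closed: "\<lbrakk>x \<in> carrier R; y \<in> carrier R\<rbrakk> \<Longrightarrow> x \<otimes> y \<in> carrier R"
    and m_assoc: "\<lbrakk>x \<in> carrier R; y \<in> carrier R; z \<in> carrier R\<rbrakk>
      \<Longrightarrow> (x \<otimes> y) \<otimes> z = x \<otimes> (y \<otimes> z)"
    and m_comm: "\<lbrakk>x \<in> carrier R; y \<in> carrier R\<rbrakk> \<Longrightarrow> x \<otimes> y = y \<otimes> x"
    and l_distr: "\<lbrakk>x \<in> carrier R; y \<in> carrier R; z \<in> carrier R\<rbrakk>
      \<Longrightarrow> (x \<oplus> y) \<otimes> z = x \<otimes> z \<oplus> y \<otimes> z"

text \<open>The locales \<open>ideal\<close> and \<open>primeideal\<close> of the library require an identity.\<close>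

definition rng_ideal :: "'a set \<Rightarrow> ('a, 'm) ring_scheme \<Rightarrow> bool" where
  "rng_ideal I S \<longleftrightarrow> additive_subgroup I S \<and>
     (\<forall>a\<in>I. \<forall>x\<in>carrier S. x \<otimes>\<^bsub>S\<^esub> a \<in> I \<and> a \<otimes>\<^bsub>S\<^esub> x \<in> I)"

definition rng_primeideal :: "'a set \<Rightarrow> ('a, 'm) ring_scheme \<Rightarrow> bool" where
  "rng_primeideal P S \<longleftrightarrow> rng_ideal P S \<and> P \<noteq> carrier S \<and>
     (\<forall>a\<in>carrier S. \<forall>b\<in>carrier S. a \<otimes>\<^bsub>S\<^esub> b \<in> P \<longrightarrow> a \<in> P \<or> b \<in> P)"

lemma (in cring) rng_primeideal_iff: "rng_primeideal P R \<longleftrightarrow> primeideal P R"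
proof
  assume "rng_primeideal P R"
  then show "primeideal P R"
    unfolding rng_primeideal_def rng_ideal_def
    by (intro primeidealI idealI ring_axioms is_cring) (auto intro: additive_subgroup.a_subgroup)
next
  assume "primeideal P R"
  then interpret primeideal P R .
  show "rng_primeideal P R"
    unfolding rng_primeideal_def rng_ideal_def
    using I_l_closed I_r_closed I_prime I_notcarr is_additive_subgroup by auto
qed

definition prime_ideals :: "('a, 'm) ring_scheme \<Rightarrow> 'a set set" where
  "prime_ideals S = {P. rng_primeideal P S}"

definition nilradical :: "('a, 'm) ring_scheme \<Rightarrow> 'a set" where
  "nilradical S = {x \<in> carrier S. \<forall>P\<in>prime_ideals S. x \<in> P}"


section \<open>The Zariski topology\<close>

definition basic_open :: "('a, 'm) ring_scheme \<Rightarrow> 'a \<Rightarrow> 'a set set" where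
  "basic_open S a = {P \<in> prime_ideals S. a \<notin> P}"

definition Spec :: "('a, 'm) ring_scheme \<Rightarrow> 'a set topology" where
  "Spec S = topology_generated_by (basic_open S ` carrier S)"

lemma topspace_Spec: "topspace (Spec S) = prime_ideals S"
proof -
  have "\<exists>a\<in>carrier S. a \<notin> P" if "P \<in> prime_ideals S" for P
    using that additive_subgroup.a_subset[of P S]
    unfolding prime_ideals_def rng_primeideal_def rng_ideal_def by blast
  then show ?thesis
    unfolding Spec_def topology_generated_by_topspace basic_open_def by blast
qed

lemma (in comm_rng) basic_open_mult:
  assumes "a \<in> carrier R" "b \<in> carrier R"
  shows "basic_open R a \<inter> basic_open R b = basic_open R (a \<otimes> b)"
  using assms unfolding basic_open_def prime_ideals_def rng_primeideal_def rng_ideal_def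
  by blast

text \<open>The generating family is a basis, not merely a subbasis.\<close>

lemma (in comm_rng) openin_Spec_iff:
  "openin (Spec R) U \<longleftrightarrow> (\<exists>A\<subseteq>carrier R. U = (\<Union>a\<in>A. basic_open R a))"
proof
  assume "openin (Spec R) U"
  then have "generate_topology_on (basic_open R ` carrier R) U"
    by (simp add: Spec_def openin_topology_generated_by_iff)
  then show "\<exists>A\<subseteq>carrier R. U = (\<Union>a\<in>A. basic_open R a)"
  proof induction
    case Empty
    show ?case by (rule exI[of _ "{}"]) auto
  next
    case (Int U V)
    then obtain A B where AB: "A \<subseteq> carrier R" "U = (\<Union>a\<in>A. basic_open R a)"
      "B \<subseteq> carrier R" "V = (\<Union>b\<in>B. basic_open R b)"
      by auto
    have "U \<inter> V = (\<Union>a\<in>A. \<Union>b\<in>B. basic_open R a \<inter> basic_open R b)"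
      using AB by auto
    also have "\<dots> = (\<Union>a\<in>A. \<Union>b\<in>B. basic_open R (a \<otimes> b))"
      using AB by (intro SUP_cong refl basic_open_mult) auto
    also have "\<dots> = (\<Union>c\<in>{a \<otimes> b |a b. a \<in> A \<and> b \<in> B}. basic_open R c)"
      by auto
    finally have "U \<inter> V = (\<Union>c\<in>{a \<otimes> b |a b. a \<in> A \<and> b \<in> B}. basic_open R c)" .
    moreover have "{a \<otimes> b |a b. a \<in> A \<and> b \<in> B} \<subseteq> carrier R"
      using AB(1,3) m_closed by blast
    ultimately show ?case by blast
  next
    case (UN K)
    then obtain A where "\<And>k. k \<in> K \<Longrightarrow> A k \<subseteq> carrier R \<and> k = (\<Union>a\<in>A k. basic_open R a)"
      by metis
    then show ?case
      by (intro exI[of _ "\<Union>k\<in>K. A k"]) auto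
  next
    case (Basis s)
    then obtain a where "a \<in> carrier R" "s = basic_open R a" by auto
    then show ?case by (intro exI[of _ "{a}"]) auto
  qed
next
  assume "\<exists>A\<subseteq>carrier R. U = (\<Union>a\<in>A. basic_open R a)"
  then obtain A where "A \<subseteq> carrier R" "U = (\<Union>a\<in>A. basic_open R a)" by blast
  moreover have "openin (Spec R) (basic_open R a)" if "a \<in> carrier R" for a
    using that unfolding Spec_def by (intro topology_generated_by_Basis) auto
  ultimately show "openin (Spec R) U"
    by (auto intro!: openin_Union)
qed


section \<open>Categories and functors\<close>

text \<open>
  Hom-sets need not be disjoint, so composition takes the three objects as arguments:
  \<open>Comp C X Y Z g f\<close> is \<open>g\<close> after \<open>f\<close> for \<open>f\<close> from \<open>X\<close> to \<open>Y\<close> and \<open>g\<close> from \<open>Y\<close> to \<open>Z\<close>.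
\<close>

record ('o, 'f) cat =
  Ob :: "'o set"
  Mor :: "'o \<Rightarrow> 'o \<Rightarrow> 'f set"
  Ident :: "'o \<Rightarrow> 'f"
  Comp :: "'o \<Rightarrow> 'o \<Rightarrow> 'o \<Rightarrow> 'f \<Rightarrow> 'f \<Rightarrow> 'f"

locale category =
  fixes C :: "('o, 'f) cat"
  assumes ident_closed: "X \<in> Ob C \<Longrightarrow> Ident C X \<in> Mor C X X"
    and comp_closed: "\<lbrakk>X \<in> Ob C; Y \<in> Ob C; Z \<in> Ob C; f \<in> Mor C X Y; g \<in> Mor C Y Z\<rbrakk>
      \<Longrightarrow> Comp C X Y Z g f \<in> Mor C X Z"
    and comp_ident: "\<lbrakk>X \<in> Ob C; Y \<in> Ob C; f \<in> Mor C X Y\<rbrakk> \<Longrightarrow> Comp C X X Y f (Ident C X) = f"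
    and ident_comp: "\<lbrakk>X \<in> Ob C; Y \<in> Ob C; f \<in> Mor C X Y\<rbrakk> \<Longrightarrow> Comp C X Y Y (Ident C Y) f = f"
    and comp_assoc: "\<lbrakk>X \<in> Ob C; Y \<in> Ob C; Z \<in> Ob C; V \<in> Ob C;
        f \<in> Mor C X Y; g \<in> Mor C Y Z; h \<in> Mor C Z V\<rbrakk>
      \<Longrightarrow> Comp C X Z V h (Comp C X Y Z g f) = Comp C X Y V (Comp C Y Z V h g) f"

record ('o, 'f, 'p, 'g) ftor =
  on_ob :: "'o \<Rightarrow> 'p"
  on_mor :: "'o \<Rightarrow> 'o \<Rightarrow> 'f \<Rightarrow> 'g"

definition ftor_comp ::
    "('p, 'g, 'q, 'h) ftor \<Rightarrow> ('o, 'f, 'p, 'g) ftor \<Rightarrow> ('o, 'f, 'q, 'h) ftor"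
    (infixr \<open>\<circ>\<^sub>F\<close> 55) where
  "G \<circ>\<^sub>F F = \<lparr>on_ob = \<lambda>X. on_ob G (on_ob F X),
     on_mor = \<lambda>X Y f. on_mor G (on_ob F X) (on_ob F Y) (on_mor F X Y f)\<rparr>"

locale contravariant_functor = C: category C + D: category D
  for C :: "('o, 'f) cat" and D :: "('p, 'g) cat" +
  fixes F :: "('o, 'f, 'p, 'g) ftor"
  assumes on_ob: "X \<in> Ob C \<Longrightarrow> on_ob F X \<in> Ob D"
    and on_mor: "\<lbrakk>X \<in> Ob C; Y \<in> Ob C; f \<in> Mor C X Y\<rbrakk>
      \<Longrightarrow> on_mor F X Y f \<in> Mor D (on_ob F Y) (on_ob F X)"
    and on_ident: "X \<in> Ob C \<Longrightarrow> on_mor F X X (Ident C X) = Ident D (on_ob F X)"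
    and on_comp: "\<lbrakk>X \<in> Ob C; Y \<in> Ob C; Z \<in> Ob C; f \<in> Mor C X Y; g \<in> Mor C Y Z\<rbrakk>
      \<Longrightarrow> on_mor F X Z (Comp C X Y Z g f)
        = Comp D (on_ob F Z) (on_ob F Y) (on_ob F X) (on_mor F X Y f) (on_mor F Y Z g)"

text \<open>
  Morphisms are represented by extensional functions, so that HOL equality of morphisms is
  equality on the underlying set of the source.
\<close>

definition top_hom :: "'x topology \<Rightarrow> 'y topology \<Rightarrow> ('x \<Rightarrow> 'y) set" where
  "top_hom X Y = {f \<in> extensional (topspace X). continuous_map X Y f}"

definition Top :: "('x topology, 'x \<Rightarrow> 'x) cat" where
  "Top = \<lparr>Ob = UNIV, Mor = top_hom, Ident = \<lambda>X. \<lambda>x\<in>topspace X. x,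
     Comp = \<lambda>X Y Z g f. compose (topspace X) g f\<rparr>"

text \<open>
  Two functors into topological spaces may take values in spaces over different HOL types,
  hence in two instances of \<^const>\<open>Top\<close>; the components of a natural transformation are
  then the morphisms \<^const>\<open>top_hom\<close> between spaces over these two types.
\<close>

locale top_contravariant_natural_transformation =
  F: contravariant_functor C Top F + G: contravariant_functor C Top G
  for C :: "('o, 'f) cat"
    and F :: "('o, 'f, 'x topology, 'x \<Rightarrow> 'x) ftor"
    and G :: "('o, 'f, 'y topology, 'y \<Rightarrow> 'y) ftor" +
  fixes \<eta> :: "'o \<Rightarrow> 'x \<Rightarrow> 'y"
  assumes component: "X \<in> Ob C \<Longrightarrow> \<eta> X \<in> top_hom (on_ob F X) (on_ob G X)"
    and naturality: "\<lbrakk>X \<in> Ob C; Y \<in> Ob C; f \<in> Mor C X Y\<rbrakk>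
      \<Longrightarrow> compose (topspace (on_ob F Y)) (\<eta> X) (on_mor F X Y f)
        = compose (topspace (on_ob F Y)) (on_mor G X Y f) (\<eta> Y)"


section \<open>i-extensions and the functors between them\<close>

definition i_extension :: "('a, 'm) ring_scheme \<Rightarrow> ('a, 'n) ring_scheme \<Rightarrow> bool" where
  "i_extension S R \<longleftrightarrow> comm_rng S \<and> comm_rng R \<and> rng_ideal (carrier S) R \<and>
     (\<forall>x\<in>carrier S. \<forall>y\<in>carrier S. x \<oplus>\<^bsub>S\<^esub> y = x \<oplus>\<^bsub>R\<^esub> y \<and> x \<otimes>\<^bsub>S\<^esub> y = x \<otimes>\<^bsub>R\<^esub> y)"

definition psi :: "('a, 'm) ring_scheme \<Rightarrow> ('a, 'n) ring_scheme \<Rightarrow> 'a set \<Rightarrow> 'a set" where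
  "psi S R I = {x \<in> carrier R. \<forall>s\<in>carrier S. x \<otimes>\<^bsub>R\<^esub> s \<in> I}"

definition E_cat :: "('a ring \<times> 'a ring, 'a \<Rightarrow> 'a) cat" where
  "E_cat = \<lparr>
     Ob = {(S, R). cring R \<and> i_extension S R},
     Mor = \<lambda>(S\<^sub>1, R\<^sub>1) (S\<^sub>2, R\<^sub>2).
       {h \<in> ring_hom R\<^sub>1 R\<^sub>2. h \<in> extensional (carrier R\<^sub>1) \<and> h ` carrier S\<^sub>1 = carrier S\<^sub>2},
     Ident = \<lambda>(S, R). \<lambda>x\<in>carrier R. x,
     Comp = \<lambda>X Y Z g f. compose (carrier (snd X)) g f\<rparr>"

definition W_functor :: "('a ring \<times> 'a ring, 'a \<Rightarrow> 'a, 'a ring, 'a \<Rightarrow> 'a) ftor" where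
  "W_functor = \<lparr>on_ob = \<lambda>(S, R). S, on_mor = \<lambda>(S, R) (T, M) h. restrict h (carrier S)\<rparr>"

text \<open>
  The image of a coset \<open>A\<close> of \<open>psi S R (nilradical S)\<close> is the coset
  \<open>h r + psi T M (nilradical T)\<close> for any \<open>r \<in> A\<close>; it is unique for every morphism \<open>h\<close>.
\<close>

definition Q_functor :: "('a ring \<times> 'a ring, 'a \<Rightarrow> 'a, 'a set ring, 'a set \<Rightarrow> 'a set) ftor" where
  "Q_functor = \<lparr>
     on_ob = \<lambda>(S, R). R Quot psi S R (nilradical S),
     on_mor = \<lambda>(S, R) (T, M) h. \<lambda>A\<in>carrier (R Quot psi S R (nilradical S)).
       the_elem ((\<lambda>r. psi T M (nilradical T) +>\<^bsub>M\<^esub> h r) ` A)\<rparr>"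

definition Spec_functor :: "('a ring, 'a \<Rightarrow> 'a, 'a set topology, 'a set \<Rightarrow> 'a set) ftor" where
  "Spec_functor = \<lparr>on_ob = Spec,
     on_mor = \<lambda>A B h. \<lambda>P\<in>prime_ideals B. {x \<in> carrier A. h x \<in> P}\<rparr>"

definition NC_functor ::
    "('a ring \<times> 'a ring, 'a \<Rightarrow> 'a, 'a set set topology, 'a set set \<Rightarrow> 'a set set) ftor" where
  "NC_functor = Spec_functor \<circ>\<^sub>F Q_functor"

text \<open>\<open>psi S R P / psi S R (nilradical S)\<close> is the set of the cosets of elements of \<open>psi S R P\<close>.\<close>

definition lambda_nt :: "'a ring \<times> 'a ring \<Rightarrow> 'a set \<Rightarrow> 'a set set" where
  "lambda_nt = (\<lambda>(S, R). \<lambda>P\<in>prime_ideals S.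
     (\<lambda>x. psi S R (nilradical S) +>\<^bsub>R\<^esub> x) ` psi S R P)"

end

(*
  Since h maps S onto T, h(r) T is the image of r S, so h(r) lies in psi(P) exactly if r lies in
  psi(h^-1(P)); this is naturality, and taking the intersection over all P it also shows that Q is
  well defined on morphisms.  For continuity, the inverse image under lambda of the basic open set
  of the coset of r is the union of the sets D(rs), s in S.
*)
theory Submission
  imports Defs
begin

section \<open>Homomorphisms of rings without identity\<close>

lemma rng_idealD:
  assumes "rng_ideal I S"
  shows "I \<subseteq> carrier S" "\<zero>\<^bsub>S\<^esub> \<in> I"
    "\<And>x y. \<lbrakk>x \<in> I; y \<in> I\<rbrakk> \<Longrightarrow> x \<oplus>\<^bsub>S\<^esub> y \<in> I"
    "\<And>x. x \<in> I \<Longrightarrow> \<ominus>\<^bsub>S\<^esub> x \<in> I"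
    "\<And>x a. \<lbrakk>a \<in> I; x \<in> carrier S\<rbrakk> \<Longrightarrow> x \<otimes>\<^bsub>S\<^esub> a \<in> I"
    "\<And>x a. \<lbrakk>a \<in> I; x \<in> carrier S\<rbrakk> \<Longrightarrow> a \<otimes>\<^bsub>S\<^esub> x \<in> I"
proof -
  interpret additive_subgroup I S using assms by (simp add: rng_ideal_def)
  show "I \<subseteq> carrier S" by (rule a_subset)
  show "\<zero>\<^bsub>S\<^esub> \<in> I" by (rule zero_closed)
  show "x \<oplus>\<^bsub>S\<^esub> y \<in> I" if "x \<in> I" "y \<in> I" for x y using that by (rule a_closed)
  show "\<ominus>\<^bsub>S\<^esub> x \<in> I" if "x \<in> I" for x using that by (rule a_inv_closed)
  show "x \<otimes>\<^bsub>S\<^esub> a \<in> I" "a \<otimes>\<^bsub>S\<^esub> x \<in> I" if "a \<in> I" "x \<in> carrier S" for x a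
    using assms that unfolding rng_ideal_def by blast+
qed

lemma (in comm_rng) rng_idealI:
  assumes "I \<subseteq> carrier R" "\<zero> \<in> I"
    and "\<And>x y. \<lbrakk>x \<in> I; y \<in> I\<rbrakk> \<Longrightarrow> x \<oplus> y \<in> I"
    and "\<And>x. x \<in> I \<Longrightarrow> \<ominus> x \<in> I"
    and "\<And>x a. \<lbrakk>a \<in> I; x \<in> carrier R\<rbrakk> \<Longrightarrow> x \<otimes> a \<in> I"
  shows "rng_ideal I R"
  unfolding rng_ideal_def
proof (intro conjI ballI)
  show "additive_subgroup I R"
    using assms by (intro additive_subgroupI add.subgroupI) (auto simp: a_inv_def)
  fix a x assume ax: "a \<in> I" "x \<in> carrier R"
  then show "x \<otimes> a \<in> I" using assms by blast
  then show "a \<otimes> x \<in> I" using m_comm[of a x] assms(1) ax by auto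
qed

lemma cring_imp_comm_rng: "cring R \<Longrightarrow> comm_rng R"
proof -
  assume "cring R"
  then interpret cring R .
  show ?thesis
    by unfold_locales (auto simp: m_ac l_distr r_distr)
qed

text \<open>An intersection of ideals inside \<open>carrier R\<close>; if there are no primes it is
  all of \<open>carrier R\<close>, so the empty family needs no separate case.\<close>

lemma (in comm_rng) rng_ideal_nilradical: "rng_ideal (nilradical R) R"
proof -
  have "rng_ideal P R" if "P \<in> prime_ideals R" for P
    using that by (simp add: prime_ideals_def rng_primeideal_def)
  note P = rng_idealD[OF this]
  show ?thesis
    by (rule rng_idealI) (auto simp: nilradical_def m_closed P)
qed

text \<open>
  The last condition makes inverse images of prime ideals proper; both surjective and unitary
  homomorphisms satisfy it.
\<close>

definition spec_hom :: "('a, 'm) ring_scheme \<Rightarrow> ('b, 'n) ring_scheme \<Rightarrow> ('a \<Rightarrow> 'b) \<Rightarrow> bool" where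
  "spec_hom A B h \<longleftrightarrow> h \<in> carrier A \<rightarrow> carrier B \<and>
     (\<forall>x\<in>carrier A. \<forall>y\<in>carrier A.
        h (x \<oplus>\<^bsub>A\<^esub> y) = h x \<oplus>\<^bsub>B\<^esub> h y \<and> h (x \<otimes>\<^bsub>A\<^esub> y) = h x \<otimes>\<^bsub>B\<^esub> h y) \<and>
     (\<forall>P\<in>prime_ideals B. \<not> h ` carrier A \<subseteq> P)"

text \<open>Used for the maps in the image of \<open>W_functor\<close>: primes are proper, so none
  contains the image, which is all of \<open>B\<close>.\<close>

lemma spec_hom_surj:
  assumes "h ` carrier A = carrier B"
    and "\<And>x y. \<lbrakk>x \<in> carrier A; y \<in> carrier A\<rbrakk> \<Longrightarrow> h (x \<oplus>\<^bsub>A\<^esub> y) = h x \<oplus>\<^bsub>B\<^esub> h y"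
    and "\<And>x y. \<lbrakk>x \<in> carrier A; y \<in> carrier A\<rbrakk> \<Longrightarrow> h (x \<otimes>\<^bsub>A\<^esub> y) = h x \<otimes>\<^bsub>B\<^esub> h y"
  shows "spec_hom A B h"
proof -
  have "P \<subset> carrier B" if "P \<in> prime_ideals B" for P
  proof -
    have "rng_ideal P B" "P \<noteq> carrier B"
      using that by (simp_all add: prime_ideals_def rng_primeideal_def)
    then show ?thesis using rng_idealD(1)[of P B] by simp
  qed
  then have "\<not> h ` carrier A \<subseteq> P" if "P \<in> prime_ideals B" for P
    unfolding assms(1) using that by blast
  moreover have "h x \<in> carrier B" if "x \<in> carrier A" for x
    unfolding assms(1)[symmetric] using that by (rule imageI)
  ultimately show ?thesis
    by (simp add: spec_hom_def assms(2,3))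
qed

text \<open>Used for the maps in the image of \<open>Q_functor\<close>: a prime containing the image
  would contain the identity of \<open>B\<close> and hence be all of \<open>B\<close>.\<close>

lemma spec_hom_unital:
  assumes "cring A" "cring B" "h \<in> ring_hom A B"
  shows "spec_hom A B h"
proof -
  interpret A: cring A by fact
  interpret B: cring B by fact
  have "\<not> h ` carrier A \<subseteq> P" if "P \<in> prime_ideals B" for P
  proof
    interpret primeideal P B
      using that by (simp add: prime_ideals_def B.rng_primeideal_iff)
    assume "h ` carrier A \<subseteq> P"
    then have "h \<one>\<^bsub>A\<^esub> \<in> P" by (rule subsetD) simp
    then have "\<one>\<^bsub>B\<^esub> \<in> P" by (simp add: ring_hom_one[OF assms(3)])
    then have "P = carrier B" by (rule one_imp_carrier)
    then show False using I_notcarr by simp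
  qed
  then show ?thesis
    using assms(3) by (simp add: spec_hom_def ring_hom_def)
qed

text \<open>Ideal axioms and primality pull back along any map preserving sums and products;
  properness is exactly the last clause of \<open>spec_hom\<close>.\<close>

lemma prime_ideals_vimage:
  assumes "comm_rng A" "comm_rng B" "spec_hom A B h" "P \<in> prime_ideals B"
  shows "{x \<in> carrier A. h x \<in> P} \<in> prime_ideals A"
proof -
  interpret A: comm_rng A by fact
  interpret B: comm_rng B by fact
  have cl: "h x \<in> carrier B" if "x \<in> carrier A" for x
    using assms(3) that by (simp_all add: spec_hom_def Pi_iff)
  have add: "h (x \<oplus>\<^bsub>A\<^esub> y) = h x \<oplus>\<^bsub>B\<^esub> h y" and mult: "h (x \<otimes>\<^bsub>A\<^esub> y) = h x \<otimes>\<^bsub>B\<^esub> h y"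
    if "x \<in> carrier A" "y \<in> carrier A" for x y
    using assms(3) that by (simp_all add: spec_hom_def Pi_iff)
  \<comment> \<open>\<open>spec_hom\<close> speaks only of sums and products; the group homomorphism
    supplies the images of zero and of negatives, which the ideal axioms call for.\<close>
  interpret h: abelian_group_hom A B h
    by (intro abelian_group_homI group_hom.intro group_hom_axioms.intro
        A.abelian_group_axioms B.abelian_group_axioms A.a_group B.a_group)
      (auto simp: hom_def cl add)
  have P: "rng_ideal P B"
    and prime: "\<And>a b. \<lbrakk>a \<in> carrier B; b \<in> carrier B; a \<otimes>\<^bsub>B\<^esub> b \<in> P\<rbrakk> \<Longrightarrow> a \<in> P \<or> b \<in> P"
    using assms(4) by (auto simp: prime_ideals_def rng_primeideal_def)
  have "rng_ideal {x \<in> carrier A. h x \<in> P} A"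
    by (rule A.rng_idealI) (auto simp: cl mult A.m_closed rng_idealD[OF P])
  moreover have "{x \<in> carrier A. h x \<in> P} \<noteq> carrier A"
  proof
    assume "{x \<in> carrier A. h x \<in> P} = carrier A"
    then have "h ` carrier A \<subseteq> P" by blast
    then show False using assms(3,4) by (simp add: spec_hom_def)
  qed
  ultimately show ?thesis
    unfolding prime_ideals_def rng_primeideal_def
    using prime cl by (auto simp: mult)
qed

section \<open>The functor of spectra\<close>

text \<open>Morphisms of \<open>Top\<close> are extensional, so identities and composites are
  continuous maps cut down to the source space.\<close>

lemma continuous_map_restrict:
  "continuous_map X Y f \<Longrightarrow> continuous_map X Y (restrict f (topspace X))"
  by (rule continuous_map_eq) auto

lemma category_Top: "category Top"
proof
  fix X Y Z :: "'a topology" and f g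
  assume "f \<in> Mor Top X Y" "g \<in> Mor Top Y Z"
  then show "Comp Top X Y Z g f \<in> Mor Top X Z"
    using continuous_map_restrict[OF continuous_map_compose[of X Y f Z g]]
    by (simp add: Top_def top_hom_def compose_def comp_def)
next
  fix X Y Z V :: "'a topology" and f g h
  assume "f \<in> Mor Top X Y" "g \<in> Mor Top Y Z" "h \<in> Mor Top Z V"
  then show "Comp Top X Z V h (Comp Top X Y Z g f) = Comp Top X Y V (Comp Top Y Z V h g) f"
    by (auto simp: Top_def top_hom_def dest: continuous_map_funspace intro: compose_assoc)
qed (auto simp: Top_def top_hom_def continuous_map_restrict compose_Id Id_compose
    dest: continuous_map_funspace)

text \<open>Continuity into a generated topology is tested on generators, and the preimage of
  \<open>basic_open A a\<close> is the set in the last assumption.\<close>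

lemma top_hom_SpecI:
  assumes "comm_rng A"
    and "f \<in> prime_ideals B \<rightarrow> prime_ideals A" "f \<in> extensional (prime_ideals B)"
    and "\<And>a. a \<in> carrier A \<Longrightarrow> openin (Spec B) {P \<in> prime_ideals B. a \<notin> f P}"
  shows "f \<in> top_hom (Spec B) (Spec A)"
proof -
  have "continuous_map (Spec B) (Spec A) f"
    unfolding Spec_def[of A]
  proof (rule continuous_on_generated_topo)
    fix U assume "U \<in> basic_open A ` carrier A"
    then obtain a where a: "a \<in> carrier A" "U = basic_open A a" by blast
    have "f -` U \<inter> topspace (Spec B) = {P \<in> prime_ideals B. a \<notin> f P}"
      using assms(2) a(2) by (auto simp: topspace_Spec basic_open_def)
    then show "openin (Spec B) (f -` U \<inter> topspace (Spec B))"
      using assms(4) a(1) by simp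
  next
    \<comment> \<open>The generators must also cover the image of \<open>f\<close>; their union is
      the whole spectrum.\<close>
    have "\<Union> (basic_open A ` carrier A) = prime_ideals A"
      using topspace_Spec[of A] by (simp add: Spec_def topology_generated_by_topspace)
    then show "f ` topspace (Spec B) \<subseteq> \<Union> (basic_open A ` carrier A)"
      using assms(2) by (auto simp: topspace_Spec)
  qed
  then show ?thesis
    using assms(3) by (simp add: top_hom_def topspace_Spec)
qed

lemma openin_basic_open: "a \<in> carrier S \<Longrightarrow> openin (Spec S) (basic_open S a)"
  unfolding Spec_def by (intro topology_generated_by_Basis) auto

text \<open>The preimage of \<open>basic_open A a\<close> under inverse image of primes is
  \<open>basic_open B (h a)\<close>.\<close>

lemma Spec_functor_on_mor:
  assumes "comm_rng A" "comm_rng B" "spec_hom A B h"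
  shows "on_mor Spec_functor A B h \<in> top_hom (Spec B) (Spec A)"
proof (rule top_hom_SpecI)
  fix a assume a: "a \<in> carrier A"
  have "{P \<in> prime_ideals B. a \<notin> on_mor Spec_functor A B h P} = basic_open B (h a)"
    using a by (auto simp: Spec_functor_def basic_open_def)
  moreover have "h a \<in> carrier B"
    using a assms(3) by (simp add: spec_hom_def Pi_iff)
  ultimately show "openin (Spec B) {P \<in> prime_ideals B. a \<notin> on_mor Spec_functor A B h P}"
    by (simp add: openin_basic_open)
qed (use assms prime_ideals_vimage in \<open>auto simp: Spec_functor_def\<close>)

lemma prime_ideals_subset: "P \<in> prime_ideals S \<Longrightarrow> P \<subseteq> carrier S"
  by (simp add: prime_ideals_def rng_primeideal_def rng_idealD(1))

text \<open>Handles both composites at once. \<open>W_functor\<close> and \<open>Q_functor\<close>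
  land in different categories of rings, but their maps are all instances of
  \<open>spec_hom\<close>; so \<open>F\<close> is described by its values on elements rather than as
  a functor into a fixed category.\<close>

lemma contravariant_functor_Spec_comp:
  fixes F :: "('o, 'f, 'a ring, 'a \<Rightarrow> 'a) ftor"
  assumes "category C"
    and ob: "\<And>X. X \<in> Ob C \<Longrightarrow> comm_rng (on_ob F X)"
    and mor: "\<And>X Y f. \<lbrakk>X \<in> Ob C; Y \<in> Ob C; f \<in> Mor C X Y\<rbrakk>
      \<Longrightarrow> spec_hom (on_ob F X) (on_ob F Y) (on_mor F X Y f)"
    and ident: "\<And>X x. \<lbrakk>X \<in> Ob C; x \<in> carrier (on_ob F X)\<rbrakk> \<Longrightarrow> on_mor F X X (Ident C X) x = x"
    and comp: "\<And>X Y Z f g x. \<lbrakk>X \<in> Ob C; Y \<in> Ob C; Z \<in> Ob C; f \<in> Mor C X Y; g \<in> Mor C Y Z;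
        x \<in> carrier (on_ob F X)\<rbrakk>
      \<Longrightarrow> on_mor F X Z (Comp C X Y Z g f) x = on_mor F Y Z g (on_mor F X Y f x)"
  shows "contravariant_functor C Top (Spec_functor \<circ>\<^sub>F F)"
proof -
  have *: "on_mor F X Y f x \<in> carrier (on_ob F Y)"
    if "X \<in> Ob C" "Y \<in> Ob C" "f \<in> Mor C X Y" "x \<in> carrier (on_ob F X)" for X Y f x
    using mor[OF that(1-3)] that(4) by (simp add: spec_hom_def Pi_iff)
  interpret C: category C by fact
  interpret Top: category Top by (rule category_Top)
  show ?thesis
  proof
    fix X assume "X \<in> Ob C"
    then show "on_ob (Spec_functor \<circ>\<^sub>F F) X \<in> Ob Top" by (simp add: Top_def)
  next
    fix X Y f assume "X \<in> Ob C" "Y \<in> Ob C" "f \<in> Mor C X Y"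
    then show "on_mor (Spec_functor \<circ>\<^sub>F F) X Y f
        \<in> Mor Top (on_ob (Spec_functor \<circ>\<^sub>F F) Y) (on_ob (Spec_functor \<circ>\<^sub>F F) X)"
      using Spec_functor_on_mor[OF ob ob mor]
      by (simp add: Top_def ftor_comp_def) (simp add: Spec_functor_def)
  next
    fix X assume X: "X \<in> Ob C"
    have "{x \<in> carrier (on_ob F X). on_mor F X X (Ident C X) x \<in> P} = P"
      if "P \<in> prime_ideals (on_ob F X)" for P
      using prime_ideals_subset[OF that] by (auto simp: ident[OF X])
    then show "on_mor (Spec_functor \<circ>\<^sub>F F) X X (Ident C X)
        = Ident Top (on_ob (Spec_functor \<circ>\<^sub>F F) X)"
      by (auto simp: Top_def ftor_comp_def Spec_functor_def topspace_Spec intro!: restrict_ext)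
  next
    fix X Y Z f g
    assume asm: "X \<in> Ob C" "Y \<in> Ob C" "Z \<in> Ob C" "f \<in> Mor C X Y" "g \<in> Mor C Y Z"
    \<comment> \<open>The map induced by \<open>f\<close> is restricted to the primes of
      \<open>on_ob F Y\<close>, so it can be evaluated at this inverse image only once that is known
      to be prime.\<close>
    have "{x \<in> carrier (on_ob F Y). on_mor F Y Z g x \<in> P} \<in> prime_ideals (on_ob F Y)"
      if "P \<in> prime_ideals (on_ob F Z)" for P
      using asm that by (intro prime_ideals_vimage[OF ob ob mor]) auto
    then show "on_mor (Spec_functor \<circ>\<^sub>F F) X Z (Comp C X Y Z g f)
      = Comp Top (on_ob (Spec_functor \<circ>\<^sub>F F) Z) (on_ob (Spec_functor \<circ>\<^sub>F F) Y)
          (on_ob (Spec_functor \<circ>\<^sub>F F) X)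
          (on_mor (Spec_functor \<circ>\<^sub>F F) X Y f) (on_mor (Spec_functor \<circ>\<^sub>F F) Y Z g)"
      using comp[OF asm] *[OF asm(1,2,4)]
      by (auto simp: Top_def ftor_comp_def Spec_functor_def topspace_Spec compose_def
          intro!: restrict_ext)
  qed
qed

section \<open>i-extensions\<close>

locale unital_i_extension = cring R for S :: "('a, 'm) ring_scheme" and R (structure) +
  assumes i_ext: "i_extension S R"
begin

sublocale S: comm_rng S
  using i_ext by (simp add: i_extension_def)

lemma S_ideal: "rng_ideal (carrier S) R"
  using i_ext by (simp add: i_extension_def)

lemma S_subset: "s \<in> carrier S \<Longrightarrow> s \<in> carrier R"
  using rng_idealD(1)[OF S_ideal] by blast

lemma S_l_closed: "\<lbrakk>x \<in> carrier R; s \<in> carrier S\<rbrakk> \<Longrightarrow> x \<otimes> s \<in> carrier S"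
  using rng_idealD(5)[OF S_ideal] by blast

lemma S_add: "\<lbrakk>s \<in> carrier S; t \<in> carrier S\<rbrakk> \<Longrightarrow> s \<oplus>\<^bsub>S\<^esub> t = s \<oplus> t"
  and S_mult: "\<lbrakk>s \<in> carrier S; t \<in> carrier S\<rbrakk> \<Longrightarrow> s \<otimes>\<^bsub>S\<^esub> t = s \<otimes> t"
  using i_ext by (auto simp: i_extension_def)

text \<open>\<open>i_extension\<close> identifies only sums and products. The zero of
  \<open>S\<close> is its own double in \<open>R\<close>, and cancellation in the additive group of
  \<open>R\<close> forces it to be zero.\<close>

lemma S_zero: "\<zero>\<^bsub>S\<^esub> = \<zero>"
proof -
  have "\<zero>\<^bsub>S\<^esub> \<oplus> \<zero>\<^bsub>S\<^esub> = \<zero>\<^bsub>S\<^esub>"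
    using S_add[of "\<zero>\<^bsub>S\<^esub>" "\<zero>\<^bsub>S\<^esub>"] by simp
  then show ?thesis
    using S_subset[of "\<zero>\<^bsub>S\<^esub>"] by (simp add: add.l_cancel_one')
qed

lemma S_a_inv: "s \<in> carrier S \<Longrightarrow> \<ominus>\<^bsub>S\<^esub> s = \<ominus> s"
  using S_add[of "\<ominus>\<^bsub>S\<^esub> s" s] S_zero S_subset by (intro minus_equality[symmetric]) (auto simp: S.l_neg)

text \<open>\<open>I\<close> is an ideal of \<open>S\<close> only, so the products with
  \<open>s\<close> are first seen to lie in \<open>S\<close>, and sums and negatives of them are
  then formed there.\<close>

lemma ideal_psi:
  assumes "rng_ideal I S"
  shows "ideal (psi S R I) R"
proof -
  note I = rng_idealD[OF assms]
  interpret rng: comm_rng R by (rule cring_imp_comm_rng) (rule is_cring)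
  have "rng_ideal (psi S R I) R"
  proof (rule rng.rng_idealI)
    show "\<zero> \<in> psi S R I"
      using I(2) S_zero S_subset by (auto simp: psi_def)
  next
    fix x y assume xy: "x \<in> psi S R I" "y \<in> psi S R I"
    have "(x \<oplus> y) \<otimes> s \<in> I" if s: "s \<in> carrier S" for s
    proof -
      have "(x \<oplus> y) \<otimes> s = x \<otimes> s \<oplus>\<^bsub>S\<^esub> y \<otimes> s"
        using xy s S_subset S_l_closed by (simp add: psi_def l_distr S_add)
      then show ?thesis using xy s I(3) by (simp add: psi_def)
    qed
    then show "x \<oplus> y \<in> psi S R I" using xy by (simp add: psi_def)
  next
    fix x assume x: "x \<in> psi S R I"
    have "(\<ominus> x) \<otimes> s \<in> I" if s: "s \<in> carrier S" for s
    proof -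
      have "(\<ominus> x) \<otimes> s = \<ominus>\<^bsub>S\<^esub> (x \<otimes> s)"
        using x s S_subset S_l_closed by (simp add: psi_def l_minus S_a_inv)
      then show ?thesis using x s I(4) by (simp add: psi_def)
    qed
    then show "\<ominus> x \<in> psi S R I" using x by (simp add: psi_def)
  next
    fix x a assume xa: "a \<in> psi S R I" "x \<in> carrier R"
    have "(x \<otimes> a) \<otimes> s \<in> I" if s: "s \<in> carrier S" for s
    proof -
      \<comment> \<open>Since \<open>S\<close> is an ideal of \<open>R\<close>, the factor
        \<open>x\<close> can be absorbed into \<open>s\<close>; the result is \<open>a\<close> times
        an element of \<open>S\<close>.\<close>
      have "(x \<otimes> a) \<otimes> s = a \<otimes> (x \<otimes> s)"
        using xa s S_subset by (simp add: psi_def m_ac)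
      then show ?thesis using xa s S_l_closed by (simp add: psi_def)
    qed
    then show "x \<otimes> a \<in> psi S R I" using xa by (simp add: psi_def)
  qed (auto simp: psi_def)
  then show ?thesis
    by (intro idealI ring_axioms)
      (auto simp: rng_ideal_def intro: additive_subgroup.a_subgroup)
qed

text \<open>Properness: if the identity were in \<open>psi S R P\<close>, then all of
  \<open>S\<close> would lie in \<open>P\<close>. Primality: if \<open>s\<close> and
  \<open>t\<close> witness that \<open>a\<close> and \<open>b\<close> are outside, then
  \<open>a s\<close> and \<open>b t\<close> are elements of \<open>S\<close> outside
  \<open>P\<close>, yet their product regroups as \<open>a b\<close> times \<open>s t\<close>, which
  is in \<open>P\<close>.\<close>

lemma primeideal_psi:
  assumes "P \<in> prime_ideals S"
  shows "primeideal (psi S R P) R"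
proof (rule primeidealI)
  have P: "rng_ideal P S" "P \<noteq> carrier S"
    and prime: "\<And>a b. \<lbrakk>a \<in> carrier S; b \<in> carrier S; a \<otimes>\<^bsub>S\<^esub> b \<in> P\<rbrakk> \<Longrightarrow> a \<in> P \<or> b \<in> P"
    using assms by (auto simp: prime_ideals_def rng_primeideal_def)
  show "ideal (psi S R P) R" by (rule ideal_psi) (rule P)
  show "carrier R \<noteq> psi S R P"
  proof
    assume "carrier R = psi S R P"
    then have "\<one> \<in> psi S R P" using one_closed by simp
    then have "carrier S \<subseteq> P" using S_subset by (auto simp: psi_def)
    then show False using subset_antisym[OF rng_idealD(1)[OF P(1)]] P(2) by simp
  qed
  fix a b assume ab: "a \<in> carrier R" "b \<in> carrier R" "a \<otimes> b \<in> psi S R P"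
  show "a \<in> psi S R P \<or> b \<in> psi S R P"
  proof (rule ccontr)
    assume "\<not> ?thesis"
    then obtain s t where st: "s \<in> carrier S" "t \<in> carrier S" "a \<otimes> s \<notin> P" "b \<otimes> t \<notin> P"
      using ab by (auto simp: psi_def)
    have "(a \<otimes> s) \<otimes>\<^bsub>S\<^esub> (b \<otimes> t) = (a \<otimes> b) \<otimes> (s \<otimes> t)"
      using ab st S_subset S_l_closed by (simp add: S_mult m_ac)
    also have "\<dots> \<in> P"
      using ab(3) S_l_closed[OF S_subset[OF st(1)] st(2)] by (simp add: psi_def)
    finally show False
      using prime[of "a \<otimes> s" "b \<otimes> t"] ab st S_l_closed by blast
  qed
qed (rule is_cring)

lemma ideal_psi_nilradical: "ideal (psi S R (nilradical S)) R"
  by (rule ideal_psi) (rule S.rng_ideal_nilradical)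

text \<open>\<open>psi\<close> is monotone in the ideal and the nilradical lies in every
  prime.\<close>

lemma psi_nilradical_subset: "P \<in> prime_ideals S \<Longrightarrow> psi S R (nilradical S) \<subseteq> psi S R P"
  by (rule subsetI) (simp add: psi_def nilradical_def)

end

section \<open>Cosets and primes of a quotient ring\<close>

lemma (in ideal) rcos_eq_iff:
  assumes "x \<in> carrier R" "y \<in> carrier R"
  shows "I +> x = I +> y \<longleftrightarrow> x \<ominus> y \<in> I"
  using quotient_eq_iff_same_a_r_cos[OF ideal_axioms assms] by simp

lemma carrier_Quot: "carrier (R Quot I) = (\<lambda>x. I +>\<^bsub>R\<^esub> x) ` carrier R"
  by (auto simp: FactRing_simps)

text \<open>Because \<open>I\<close> lies in \<open>P\<close>, the ideal \<open>P\<close> is a union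
  of cosets of \<open>I\<close>, so any representative decides.\<close>

lemma (in ideal) rcos_in_image_iff:
  assumes "ideal P R" "I \<subseteq> P" "x \<in> carrier R"
  shows "I +> x \<in> (\<lambda>y. I +> y) ` P \<longleftrightarrow> x \<in> P"
proof
  interpret P: ideal P R by fact
  assume "I +> x \<in> (\<lambda>y. I +> y) ` P"
  then obtain y where y: "y \<in> P" "I +> x = I +> y" by blast
  then have "x \<ominus> y \<in> P"
    using rcos_eq_iff[of x y] assms(2,3) P.Icarr by blast
  then have "(x \<ominus> y) \<oplus> y \<in> P" using y by (simp add: P.a_closed)
  moreover have "(x \<ominus> y) \<oplus> y = x"
    using assms(3) P.Icarr[OF y(1)] by algebra
  ultimately show "x \<in> P" by simp
qed auto

text \<open>One direction of the correspondence theorem: by \<open>rcos_in_image_iff\<close>,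
  properness and primality of the image are questions about representatives in
  \<open>R\<close>.\<close>

lemma (in ideal) prime_ideals_Quot:
  assumes "cring R" "primeideal P R" "I \<subseteq> P"
  shows "(\<lambda>x. I +> x) ` P \<in> prime_ideals (R Quot I)"
proof -
  interpret P: primeideal P R by fact
  interpret Q: comm_rng "R Quot I"
    by (intro cring_imp_comm_rng quotient_is_cring assms)
  interpret h: ring_hom_ring R "R Quot I" "\<lambda>x. I +> x"
    by (rule rcos_ring_hom_ring)
  note iff = rcos_in_image_iff[OF P.ideal_axioms assms(3)]
  let ?P = "(\<lambda>x. I +> x) ` P"
  have "rng_ideal ?P (R Quot I)"
  proof (rule Q.rng_idealI)
    show "?P \<subseteq> carrier (R Quot I)" using P.Icarr by (auto simp: carrier_Quot)
    show "\<zero>\<^bsub>R Quot I\<^esub> \<in> ?P" using h.hom_zero P.zero_closed by (metis imageI)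
  qed (auto simp: carrier_Quot P.Icarr P.I_l_closed simp flip: h.hom_add h.hom_a_inv h.hom_mult)
  moreover have "?P \<noteq> carrier (R Quot I)"
  proof
    assume "?P = carrier (R Quot I)"
    then have "carrier R \<subseteq> P" using iff by (auto simp: carrier_Quot)
    then show False using P.I_notcarr P.a_subset by blast
  qed
  moreover have "A \<in> ?P \<or> B \<in> ?P"
    if AB: "A \<in> carrier (R Quot I)" "B \<in> carrier (R Quot I)" "A \<otimes>\<^bsub>R Quot I\<^esub> B \<in> ?P" for A B
  proof -
    obtain a b where "a \<in> carrier R" "b \<in> carrier R" "A = I +> a" "B = I +> b"
      using AB(1,2) unfolding carrier_Quot by blast
    then show ?thesis
      using AB(3) iff P.I_prime[of a b] by (simp flip: h.hom_mult)
  qed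
  ultimately show ?thesis
    by (simp add: prime_ideals_def rng_primeideal_def)
qed

section \<open>The category of i-extensions\<close>

lemma Ob_E_cat: "(S, R) \<in> Ob E_cat \<longleftrightarrow> unital_i_extension S R"
  by (simp add: E_cat_def unital_i_extension_def unital_i_extension_axioms_def)

lemma Mor_E_cat: "h \<in> Mor E_cat (S, R) (T, M) \<longleftrightarrow>
    h \<in> ring_hom R M \<and> h \<in> extensional (carrier R) \<and> h ` carrier S = carrier T"
  by (simp add: E_cat_def)

lemma category_E_cat: "category E_cat"
proof -
  have id: "Ident E_cat (S, R) = (\<lambda>x\<in>carrier R. x)" for S R :: "'a ring"
    by (simp add: E_cat_def)
  have comp: "Comp E_cat (S, R) Y Z g f = compose (carrier R) g f" for S R :: "'a ring" and Y Z g f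
    by (simp add: E_cat_def)
  show ?thesis
  proof (unfold_locales, unfold split_paired_all id comp Ob_E_cat Mor_E_cat)
    fix S R :: "'a ring" assume "unital_i_extension S R"
    then interpret unital_i_extension S R .
    show "restrict (\<lambda>x. x) (carrier R) \<in> ring_hom R R \<and>
        restrict (\<lambda>x. x) (carrier R) \<in> extensional (carrier R) \<and>
        restrict (\<lambda>x. x) (carrier R) ` carrier S = carrier S"
      using S_subset by (auto simp: ring_hom_def)
  next
    fix S R T M U L :: "'a ring" and f g
    assume "unital_i_extension S R" "unital_i_extension T M"
      and f: "f \<in> ring_hom R M \<and> f \<in> extensional (carrier R) \<and> f ` carrier S = carrier T"
      and g: "g \<in> ring_hom M L \<and> g \<in> extensional (carrier M) \<and> g ` carrier T = carrier U"
    then interpret unital_i_extension S R by simp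
    have "compose (carrier R) g f \<in> ring_hom R L"
      using f g by (auto simp: ring_hom_def compose_eq Pi_iff)
    \<comment> \<open>\<open>compose\<close> agrees with successive application on
      \<open>carrier R\<close>, which contains \<open>S\<close>.\<close>
    moreover have "compose (carrier R) g f ` carrier S = g ` f ` carrier S"
      using S_subset by (force simp: compose_eq image_image intro!: image_cong)
    ultimately show "compose (carrier R) g f \<in> ring_hom R L \<and>
        compose (carrier R) g f \<in> extensional (carrier R) \<and>
        compose (carrier R) g f ` carrier S = carrier U"
      using f g by simp
  qed (auto simp: compose_Id Id_compose ring_hom_def intro!: compose_assoc)
qed

section \<open>Morphisms of i-extensions: their effect on primes, on \<open>psi\<close> and on the
  quotients\<close>

locale E_morphism = dom: unital_i_extension S R + cod: unital_i_extension T M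
  for S :: "'a ring" and R :: "'a ring" and T :: "'a ring" and M :: "'a ring" +
  fixes h :: "'a \<Rightarrow> 'a"
  assumes hom: "h \<in> ring_hom R M" and image_S: "h ` carrier S = carrier T"
begin

sublocale h: ring_hom_ring R M h
  by (intro ring_hom_ringI2 dom.ring_axioms cod.ring_axioms hom)

lemma spec_hom_restrict: "spec_hom S T (restrict h (carrier S))"
proof (rule spec_hom_surj)
  have h_S: "h s \<in> carrier T" if "s \<in> carrier S" for s
    using that image_S by blast
  fix s t assume "s \<in> carrier S" "t \<in> carrier S"
  then show "restrict h (carrier S) (s \<oplus>\<^bsub>S\<^esub> t)
      = restrict h (carrier S) s \<oplus>\<^bsub>T\<^esub> restrict h (carrier S) t"
    and "restrict h (carrier S) (s \<otimes>\<^bsub>S\<^esub> t)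
      = restrict h (carrier S) s \<otimes>\<^bsub>T\<^esub> restrict h (carrier S) t"
    \<comment> \<open>The restriction is evaluated while the operations are still those of
      \<open>S\<close>, where closure applies; only afterwards are they moved to \<open>R\<close>
      and \<open>M\<close>.\<close>
    by (simp_all add: dom.S.m_closed)
      (simp_all add: dom.S_add dom.S_mult cod.S_add cod.S_mult h_S dom.S_subset)
qed (simp add: image_S)

lemma vimage_prime: "P \<in> prime_ideals T \<Longrightarrow> {s \<in> carrier S. h s \<in> P} \<in> prime_ideals S"
  using prime_ideals_vimage[OF dom.S.comm_rng_axioms cod.S.comm_rng_axioms spec_hom_restrict, of P]
  by (simp cong: conj_cong)

text \<open>Every element of \<open>T\<close> is some \<open>h s\<close>, and \<open>h r\<close>
  times \<open>h s\<close> is \<open>h\<close> of \<open>r s\<close>, where \<open>r s\<close> is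
  again in \<open>S\<close>. The set \<open>I\<close> is arbitrary, so that primes and the
  nilradical are both covered.\<close>

lemma psi_vimage_iff:
  assumes "r \<in> carrier R"
  shows "h r \<in> psi T M I \<longleftrightarrow> r \<in> psi S R {s \<in> carrier S. h s \<in> I}"
proof -
  have "h r \<in> psi T M I \<longleftrightarrow> (\<forall>s\<in>carrier S. h r \<otimes>\<^bsub>M\<^esub> h s \<in> I)"
    using assms image_S[symmetric] by (simp add: psi_def)
  also have "\<dots> \<longleftrightarrow> (\<forall>s\<in>carrier S. h (r \<otimes>\<^bsub>R\<^esub> s) \<in> I)"
    using assms dom.S_subset by simp
  also have "\<dots> \<longleftrightarrow> r \<in> psi S R {s \<in> carrier S. h s \<in> I}"
    using assms dom.S_l_closed by (simp add: psi_def)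
  finally show ?thesis .
qed

text \<open>Primes of \<open>T\<close> pull back to primes of \<open>S\<close>, so \<open>h\<close>
  maps the nilradical of \<open>S\<close> into that of \<open>T\<close>; monotonicity of
  \<open>psi\<close> and \<open>psi_vimage_iff\<close> transfer this.\<close>

lemma psi_nilradical:
  assumes "r \<in> psi S R (nilradical S)"
  shows "h r \<in> psi T M (nilradical T)"
proof -
  have "nilradical S \<subseteq> {s \<in> carrier S. h s \<in> nilradical T}"
  proof
    fix s assume s: "s \<in> nilradical S"
    have "h s \<in> P" if "P \<in> prime_ideals T" for P
      using s vimage_prime[OF that] by (auto simp: nilradical_def)
    then show "s \<in> {s \<in> carrier S. h s \<in> nilradical T}"
      using s image_S by (auto simp: nilradical_def)
  qed
  then have "r \<in> psi S R {s \<in> carrier S. h s \<in> nilradical T}"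
    using assms by (auto simp: psi_def)
  then show ?thesis
    using psi_vimage_iff[of r "nilradical T"] assms by (simp add: psi_def)
qed

text \<open>Two representatives differ by some \<open>n\<close> in
  \<open>psi S R (nilradical S)\<close>, and \<open>psi_nilradical\<close> places \<open>h n\<close>
  in the ideal divided out of \<open>M\<close>. So \<open>the_elem\<close> is applied to a
  singleton.\<close>

lemma Q_functor_on_mor:
  assumes "r \<in> carrier R"
  shows "on_mor Q_functor (S, R) (T, M) h (psi S R (nilradical S) +>\<^bsub>R\<^esub> r)
    = psi T M (nilradical T) +>\<^bsub>M\<^esub> h r"
proof -
  let ?A = "psi S R (nilradical S) +>\<^bsub>R\<^esub> r"
  interpret N: ideal "psi S R (nilradical S)" R by (rule dom.ideal_psi_nilradical)
  have "psi T M (nilradical T) +>\<^bsub>M\<^esub> h x = psi T M (nilradical T) +>\<^bsub>M\<^esub> h r" if x: "x \<in> ?A" for x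
  proof -
    obtain n where n: "n \<in> psi S R (nilradical S)" "x = n \<oplus>\<^bsub>R\<^esub> r"
      using x by (auto simp: a_r_coset_def r_coset_def)
    then have "n \<in> carrier R" by (simp add: N.Icarr)
    then have "h x = h n \<oplus>\<^bsub>M\<^esub> h r" and hn: "h n \<in> carrier M" and hr: "h r \<in> carrier M"
      using n assms by simp_all
    then have "h x \<ominus>\<^bsub>M\<^esub> h r = h n" by algebra
    then show ?thesis
      using ideal.rcos_eq_iff[OF cod.ideal_psi_nilradical, of "h x" "h r"] psi_nilradical[OF n(1)] hn hr
        \<open>h x = _\<close> by simp
  qed
  \<comment> \<open>All values being equal, this gives nonemptiness and hence a singleton.\<close>
  moreover have "r \<in> ?A" using assms by (rule N.a_rcos_self)
  ultimately have "(\<lambda>r. psi T M (nilradical T) +>\<^bsub>M\<^esub> h r) ` ?A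
      = {psi T M (nilradical T) +>\<^bsub>M\<^esub> h r}"
    by blast
  moreover have "?A \<in> carrier (R Quot psi S R (nilradical S))"
    using assms by (auto simp: carrier_Quot)
  ultimately show ?thesis by (simp add: Q_functor_def)
qed

text \<open>On representatives each law is the one for \<open>h\<close>, read through the two
  projections.\<close>

lemma Q_functor_hom: "on_mor Q_functor (S, R) (T, M) h
    \<in> ring_hom (R Quot psi S R (nilradical S)) (M Quot psi T M (nilradical T))"
proof -
  interpret p: ring_hom_ring R "R Quot psi S R (nilradical S)" "\<lambda>x. psi S R (nilradical S) +>\<^bsub>R\<^esub> x"
    by (rule ideal.rcos_ring_hom_ring[OF dom.ideal_psi_nilradical])
  interpret q: ring_hom_ring M "M Quot psi T M (nilradical T)" "\<lambda>x. psi T M (nilradical T) +>\<^bsub>M\<^esub> x"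
    by (rule ideal.rcos_ring_hom_ring[OF cod.ideal_psi_nilradical])
  show ?thesis
  proof (rule ring_hom_memI)
    show "on_mor Q_functor (S, R) (T, M) h \<one>\<^bsub>R Quot psi S R (nilradical S)\<^esub>
        = \<one>\<^bsub>M Quot psi T M (nilradical T)\<^esub>"
      by (simp add: Q_functor_on_mor flip: p.hom_one q.hom_one)
  qed (auto simp: carrier_Quot Q_functor_on_mor simp flip: p.hom_add p.hom_mult q.hom_add q.hom_mult)
qed

end

lemma E_morphismI:
  "\<lbrakk>(S, R) \<in> Ob E_cat; (T, M) \<in> Ob E_cat; h \<in> Mor E_cat (S, R) (T, M)\<rbrakk> \<Longrightarrow> E_morphism S R T M h"
  by (simp add: Ob_E_cat Mor_E_cat E_morphism_def E_morphism_axioms_def)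

section \<open>Functoriality of the two composites with the spectrum\<close>

lemma Spec_W_functor: "contravariant_functor E_cat Top (Spec_functor \<circ>\<^sub>F W_functor)"
proof (rule contravariant_functor_Spec_comp[OF category_E_cat], unfold split_paired_all)
  fix S R :: "'a ring" assume "(S, R) \<in> Ob E_cat"
  then interpret unital_i_extension S R by (simp add: Ob_E_cat)
  show "comm_rng (on_ob W_functor (S, R))"
    by (simp add: W_functor_def S.comm_rng_axioms)
  show "on_mor W_functor (S, R) (S, R) (Ident E_cat (S, R)) x = x"
    if "x \<in> carrier (on_ob W_functor (S, R))" for x
    using that S_subset by (simp add: W_functor_def E_cat_def)
next
  fix S R T M :: "'a ring" and f
  assume "(S, R) \<in> Ob E_cat" "(T, M) \<in> Ob E_cat" "f \<in> Mor E_cat (S, R) (T, M)"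
  then interpret E_morphism S R T M f by (rule E_morphismI)
  show "spec_hom (on_ob W_functor (S, R)) (on_ob W_functor (T, M))
      (on_mor W_functor (S, R) (T, M) f)"
    using spec_hom_restrict by (simp add: W_functor_def)
next
  fix S R T M U L :: "'a ring" and f g x
  assume *: "(S, R) \<in> Ob E_cat" "(T, M) \<in> Ob E_cat" "(U, L) \<in> Ob E_cat"
    "f \<in> Mor E_cat (S, R) (T, M)" "g \<in> Mor E_cat (T, M) (U, L)"
    and x: "x \<in> carrier (on_ob W_functor (S, R))"
  interpret E_morphism S R T M f using * by (intro E_morphismI)
  \<comment> \<open>Needed to evaluate the restriction of \<open>g\<close> to \<open>T\<close> at
    \<open>f x\<close>.\<close>
  have "f x \<in> carrier T" using x image_S by (auto simp: W_functor_def)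
  then show "on_mor W_functor (S, R) (U, L) (Comp E_cat (S, R) (T, M) (U, L) g f) x
      = on_mor W_functor (T, M) (U, L) g (on_mor W_functor (S, R) (T, M) f x)"
    using x dom.S_subset by (simp add: W_functor_def E_cat_def compose_eq)
qed

lemma on_ob_Q_functor: "on_ob Q_functor (S, R) = R Quot psi S R (nilradical S)"
  by (simp add: Q_functor_def)

lemma NC_functor_contravariant: "contravariant_functor E_cat Top NC_functor"
  unfolding NC_functor_def
proof (rule contravariant_functor_Spec_comp[OF category_E_cat],
    unfold split_paired_all on_ob_Q_functor)
  fix S R :: "'a ring" assume "(S, R) \<in> Ob E_cat"
  then interpret unital_i_extension S R by (simp add: Ob_E_cat)
  show "comm_rng (R Quot psi S R (nilradical S))"
    by (intro cring_imp_comm_rng ideal.quotient_is_cring[OF ideal_psi_nilradical] is_cring)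
  fix A assume "A \<in> carrier (R Quot psi S R (nilradical S))"
  then obtain r where r: "r \<in> carrier R" "A = psi S R (nilradical S) +>\<^bsub>R\<^esub> r"
    by (auto simp: carrier_Quot)
  \<comment> \<open>Viewing the identity as a morphism makes \<open>Q_functor_on_mor\<close>
    available for it.\<close>
  interpret E_morphism S R S R "Ident E_cat (S, R)"
    using category.ident_closed[OF category_E_cat] \<open>_ \<in> Ob E_cat\<close> by (intro E_morphismI) auto
  show "on_mor Q_functor (S, R) (S, R) (Ident E_cat (S, R)) A = A"
    using Q_functor_on_mor[OF r(1)] r by (simp add: E_cat_def)
next
  fix S R T M :: "'a ring" and f
  assume "(S, R) \<in> Ob E_cat" "(T, M) \<in> Ob E_cat" "f \<in> Mor E_cat (S, R) (T, M)"
  then interpret E_morphism S R T M f by (rule E_morphismI)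
  show "spec_hom (R Quot psi S R (nilradical S)) (M Quot psi T M (nilradical T))
      (on_mor Q_functor (S, R) (T, M) f)"
    by (intro spec_hom_unital Q_functor_hom ideal.quotient_is_cring[OF dom.ideal_psi_nilradical]
        ideal.quotient_is_cring[OF cod.ideal_psi_nilradical] dom.is_cring cod.is_cring)
next
  fix S R T M U L :: "'a ring" and f g A
  assume *: "(S, R) \<in> Ob E_cat" "(T, M) \<in> Ob E_cat" "(U, L) \<in> Ob E_cat"
    "f \<in> Mor E_cat (S, R) (T, M)" "g \<in> Mor E_cat (T, M) (U, L)"
    and "A \<in> carrier (R Quot psi S R (nilradical S))"
  then obtain r where r: "r \<in> carrier R" "A = psi S R (nilradical S) +>\<^bsub>R\<^esub> r"
    by (auto simp: carrier_Quot)
  interpret f: E_morphism S R T M f using * by (intro E_morphismI)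
  interpret g: E_morphism T M U L g using * by (intro E_morphismI)
  \<comment> \<open>Likewise for the composite: all three maps are then computed on the one
    representative \<open>r\<close>.\<close>
  interpret gf: E_morphism S R U L "Comp E_cat (S, R) (T, M) (U, L) g f"
    using * category.comp_closed[OF category_E_cat] by (intro E_morphismI) auto
  show "on_mor Q_functor (S, R) (U, L) (Comp E_cat (S, R) (T, M) (U, L) g f) A
      = on_mor Q_functor (T, M) (U, L) g (on_mor Q_functor (S, R) (T, M) f A)"
    using r f.Q_functor_on_mor g.Q_functor_on_mor gf.Q_functor_on_mor
    by (simp add: E_cat_def compose_eq)
qed

section \<open>The natural transformation\<close>

context unital_i_extension
begin

lemma lambda_nt_prime:
  assumes "P \<in> prime_ideals S"
  shows "(\<lambda>x. psi S R (nilradical S) +> x) ` psi S R P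
    \<in> prime_ideals (R Quot psi S R (nilradical S))"
  using assms
  by (intro ideal.prime_ideals_Quot[OF ideal_psi_nilradical] is_cring primeideal_psi psi_nilradical_subset)

text \<open>Trades cosets for representatives, in the proofs of both continuity and
  naturality.\<close>

lemma lambda_nt_iff:
  assumes "P \<in> prime_ideals S" "r \<in> carrier R"
  shows "psi S R (nilradical S) +> r \<in> (\<lambda>x. psi S R (nilradical S) +> x) ` psi S R P
    \<longleftrightarrow> r \<in> psi S R P"
  using assms
  by (intro ideal.rcos_in_image_iff[OF ideal_psi_nilradical] primeideal.axioms(1) primeideal_psi
      psi_nilradical_subset)

end

lemma lambda_nt_top_hom:
  assumes "unital_i_extension S R"
  shows "lambda_nt (S, R) \<in> top_hom (Spec S) (Spec (R Quot psi S R (nilradical S)))"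
proof -
  interpret unital_i_extension S R by fact
  show ?thesis
  proof (rule top_hom_SpecI)
    fix A assume "A \<in> carrier (R Quot psi S R (nilradical S))"
    then obtain r where r: "r \<in> carrier R" "A = psi S R (nilradical S) +>\<^bsub>R\<^esub> r"
      by (auto simp: carrier_Quot)
    \<comment> \<open>By \<open>lambda_nt_iff\<close> the condition says that \<open>r\<close> is
      outside \<open>psi S R P\<close>, that is, \<open>r s\<close> is outside \<open>P\<close> for
      some \<open>s\<close> in \<open>S\<close>; this existential is the union.\<close>
    have "{P \<in> prime_ideals S. A \<notin> lambda_nt (S, R) P} = (\<Union>s\<in>carrier S. basic_open S (r \<otimes>\<^bsub>R\<^esub> s))"
      using r lambda_nt_iff by (auto simp: lambda_nt_def basic_open_def psi_def)
    moreover have "openin (Spec S) (\<Union>s\<in>carrier S. basic_open S (r \<otimes>\<^bsub>R\<^esub> s))"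
      using r S_l_closed by (auto intro!: openin_basic_open)
    ultimately show "openin (Spec S) {P \<in> prime_ideals S. A \<notin> lambda_nt (S, R) P}"
      by simp
  qed (auto simp: lambda_nt_def lambda_nt_prime
      intro!: cring_imp_comm_rng ideal.quotient_is_cring[OF ideal_psi_nilradical] is_cring)
qed

lemma (in E_morphism) lambda_nt_natural:
  assumes "P \<in> prime_ideals T"
  shows "lambda_nt (S, R) (on_mor (Spec_functor \<circ>\<^sub>F W_functor) (S, R) (T, M) h P)
    = on_mor NC_functor (S, R) (T, M) h (lambda_nt (T, M) P)"
proof -
  let ?N = "psi S R (nilradical S)" and ?N' = "psi T M (nilradical T)"
  let ?P = "{s \<in> carrier S. h s \<in> P}"
  \<comment> \<open>\<open>lambda_nt\<close> is restricted to primes, so its value at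
    \<open>?P\<close> depends on this.\<close>
  have P: "?P \<in> prime_ideals S" by (rule vimage_prime) (rule assms)
  have "on_mor (Spec_functor \<circ>\<^sub>F W_functor) (S, R) (T, M) h P = ?P"
    using assms by (auto simp: ftor_comp_def Spec_functor_def W_functor_def)
  then have "lambda_nt (S, R) (on_mor (Spec_functor \<circ>\<^sub>F W_functor) (S, R) (T, M) h P)
      = (\<lambda>x. ?N +>\<^bsub>R\<^esub> x) ` psi S R ?P"
    using P by (simp add: lambda_nt_def)
  also have "\<dots> = {A \<in> carrier (R Quot ?N).
      on_mor Q_functor (S, R) (T, M) h A \<in> (\<lambda>x. ?N' +>\<^bsub>M\<^esub> x) ` psi T M P}"
  proof -
    \<comment> \<open>The image coset is that of \<open>h r\<close>; \<open>lambda_nt_iff\<close>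
      for \<open>T\<close> reduces the claim to \<open>h r\<close> in \<open>psi T M P\<close>, and
      \<open>psi_vimage_iff\<close> carries it back to \<open>r\<close>.\<close>
    have "on_mor Q_functor (S, R) (T, M) h (?N +>\<^bsub>R\<^esub> r) \<in> (\<lambda>x. ?N' +>\<^bsub>M\<^esub> x) ` psi T M P
        \<longleftrightarrow> r \<in> psi S R ?P" if "r \<in> carrier R" for r
      using that cod.lambda_nt_iff[OF assms, of "h r"] psi_vimage_iff[OF that]
      by (simp add: Q_functor_on_mor)
    moreover have "r \<in> carrier R" if "r \<in> psi S R ?P" for r
      using that by (simp add: psi_def)
    ultimately show ?thesis
      unfolding carrier_Quot by auto
  qed
  also have "\<dots> = on_mor NC_functor (S, R) (T, M) h (lambda_nt (T, M) P)"
    using assms cod.lambda_nt_prime[OF assms]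
    by (simp add: NC_functor_def ftor_comp_def Spec_functor_def on_ob_Q_functor lambda_nt_def)
  finally show ?thesis .
qed

theorem proposition11:
  shows "top_contravariant_natural_transformation
    (E_cat :: ('a ring \<times> 'a ring, 'a \<Rightarrow> 'a) cat)
    (Spec_functor \<circ>\<^sub>F W_functor) NC_functor lambda_nt"
proof (intro top_contravariant_natural_transformation.intro
    top_contravariant_natural_transformation_axioms.intro Spec_W_functor NC_functor_contravariant,
    unfold split_paired_all)
  fix S R :: "'a ring" assume "(S, R) \<in> Ob E_cat"
  then show "lambda_nt (S, R)
      \<in> top_hom (on_ob (Spec_functor \<circ>\<^sub>F W_functor) (S, R)) (on_ob NC_functor (S, R))"
    using lambda_nt_top_hom[of S R]
    by (simp add: Ob_E_cat NC_functor_def ftor_comp_def Spec_functor_def W_functor_def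
        on_ob_Q_functor)
next
  fix S R T M :: "'a ring" and h
  assume "(S, R) \<in> Ob E_cat" "(T, M) \<in> Ob E_cat" "h \<in> Mor E_cat (S, R) (T, M)"
  then interpret E_morphism S R T M h by (rule E_morphismI)
  have "topspace (on_ob (Spec_functor \<circ>\<^sub>F W_functor) (T, M)) = prime_ideals T"
    by (simp add: ftor_comp_def Spec_functor_def W_functor_def topspace_Spec)
  then show "compose (topspace (on_ob (Spec_functor \<circ>\<^sub>F W_functor) (T, M))) (lambda_nt (S, R))
      (on_mor (Spec_functor \<circ>\<^sub>F W_functor) (S, R) (T, M) h)
    = compose (topspace (on_ob (Spec_functor \<circ>\<^sub>F W_functor) (T, M)))
      (on_mor NC_functor (S, R) (T, M) h) (lambda_nt (T, M))"
    using lambda_nt_natural by (auto simp: compose_def intro!: restrict_ext)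
qed

end
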